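(* Let $K\subset\mathbb{R}^n$ be a nonempty semi-algebraic set and let $F_l=(F_{l1},\dots,F_{ln}):K\to\mathbb{R}^n$, $l=1,\dots,m$, be maps all of whose components $F_{lj}$ are (restrictions to $K$ of) polynomials in $x_1,\dots,x_n$ with real coefficients. Let $\Delta=\{(\xi_1,\dots,\xi_m)\in\mathbb{R}^m_+:\sum_{l=1}^m\xi_l=1\}$. Then the basic multifunction $\Phi:\Delta\rightrightarrows\mathbb{R}^n$ defined by $$\Phi(\xi)=\Big\{x\in K:\ \Big\langle\sum_{l=1}^m\xi_lF_l(x),\,y-x\Big\rangle\ge 0\ \text{ for all } y\in K\Big\}$$ is semi-algebraic.
   Context: A set in $\mathbb{R}^k$ is semi-algebraic if it is a finite union of sets of the form $\{x\in\mathbb{R}^k: f_1(x)=\dots=f_\ell(x)=0,\ g_{\ell+1}(x)<0,\dots,g_p(x)<0\}$ with all $f_i,g_j$ in $\mathbb{R}[x_1,\dots,x_k]$. For a semi-algebraic set $S\subset\mathbb{R}^m$, a multifunction (set-valued map) $\Psi:S\rightrightarrows\mathbb{R}^n$ is called semi-algebraic if its graph $\mathrm{gph}\,\Psi=\{(x,y)\in\mathbb{R}^m\times\mathbb{R}^n: x\in S,\ y\in\Psi(x)\}$ is a semi-algebraic set in $\mathbb{R}^{m+n}$. Values of a multifunction may be empty. $\langle\cdot,\cdot\rangle$ is the standard scalar product on $\mathbb{R}^n$. *)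

theory Defs
  imports "HOL-Analysis.Analysis"
begin

text \<open>
  The ambient space is an arbitrary Euclidean space, so that sets in
  \<open>real ^ 'k\<close> and sets in a product \<open>(real ^ 'm) \<times> (real ^ 'n)\<close>
  (which plays the role of the space of dimension \<open>m + n\<close>) are covered by the same
  definition. The predicate \<^const>\<open>real_polynomial_function\<close> is closed under sums and products
  and generated by the constants and the bounded linear forms; in finite dimension these
  functions are exactly those given by the real polynomials in the coordinates.
  Either of the sets \<open>E\<close> and \<open>L\<close> may be empty.
\<close>

definition basic_semialgebraic :: "'a::euclidean_space set \<Rightarrow> bool" where
  "basic_semialgebraic B \<longleftrightarrow>
     (\<exists>E L. finite E \<and> finite L \<and>
        (\<forall>f\<in>E. real_polynomial_function f) \<and> (\<forall>g\<in>L. real_polynomial_function g) \<and>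
        B = {x. (\<forall>f\<in>E. f x = 0) \<and> (\<forall>g\<in>L. g x < 0)})"

definition semialgebraic :: "'a::euclidean_space set \<Rightarrow> bool" where
  "semialgebraic S \<longleftrightarrow>
     (\<exists>\<B>. finite \<B> \<and> (\<forall>B\<in>\<B>. basic_semialgebraic B) \<and> S = \<Union>\<B>)"

text \<open>
  A multifunction with domain \<open>S\<close> is a set-valued function on the whole type
  whose values outside \<open>S\<close> are irrelevant.
\<close>

definition gph :: "'a set \<Rightarrow> ('a \<Rightarrow> 'b set) \<Rightarrow> ('a \<times> 'b) set" where
  "gph S \<Psi> = {(x, y). x \<in> S \<and> y \<in> \<Psi> x}"

text \<open>
  The notion is only meaningful over a semi-algebraic domain, hence the first conjunct.
\<close>

definition semialgebraic_multifunction ::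
    "'a::euclidean_space set \<Rightarrow> ('a \<Rightarrow> 'b::euclidean_space set) \<Rightarrow> bool" where
  "semialgebraic_multifunction S \<Psi> \<longleftrightarrow> semialgebraic S \<and> semialgebraic (gph S \<Psi>)"

definition std_simplex :: "(real ^ 'm) set" where
  "std_simplex = {\<xi>. (\<forall>l. 0 \<le> \<xi> $ l) \<and> (\<Sum>l\<in>UNIV. \<xi> $ l) = 1}"

definition basic_multifunction ::
    "(real ^ 'n) set \<Rightarrow> ('m \<Rightarrow> real ^ 'n \<Rightarrow> real ^ 'n) \<Rightarrow> real ^ 'm \<Rightarrow> (real ^ 'n) set" where
  "basic_multifunction K F \<xi> =
     {x \<in> K. \<forall>y\<in>K. (\<Sum>l\<in>UNIV. \<xi> $ l *\<^sub>R F l x) \<bullet> (y - x) \<ge> 0}"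

end

theory Submission
  imports Defs "HOL-Computational_Algebra.Fundamental_Theorem_Algebra"
begin

text \<open>
  For \<open>x \<in> K\<close> the defining inequality of the multifunction is a polynomial inequality in \<open>(\<xi>, x, y)\<close>,
  quantified over \<open>y \<in> K\<close>. A universal quantifier is the complement of a projection, so the graph is
  semialgebraic once projections of semialgebraic sets are: this is the Tarski-Seidenberg theorem
  (\<open>semialgebraic_projection\<close>), and its proof takes up most of the text.

  By \<open>semialgebraic_iff_same_signs\<close> a set is semialgebraic iff membership depends only on the
  signs of finitely many polynomials. In these terms, to project along a direction \<open>v\<close> means the
  following. The polynomials describing the set become, on the line \<open>t \<mapsto> x + t v\<close>, real polynomials in \<open>t\<close>
  whose coefficients are polynomials in \<open>x\<close>; and it has to be shown that the signs of finitely many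
  polynomials at \<open>x\<close> determine which sign vectors such a family takes when \<open>t\<close> runs through the
  line (\<open>sign_determined_finite\<close>).

  The argument is that of Cohen and Hoermander. Polynomials are added in the order of increasing
  degree. When \<open>p\<close> is added, its derivative is already present, so \<open>p\<close> is monotone
  between consecutive roots of the earlier members; and at a root of an earlier member, \<open>p\<close> has the
  sign of its remainder modulo that member, which has smaller degree and may be assumed to be present as well. So the
  sign of \<open>p\<close> is known at the ends of all intervals, and with monotonicity this determines
  the signs that \<open>p\<close> takes inside (\<open>realizes_insert\<close>).

  The classical proof keeps a table of the roots in their order. Thom's lemma (\<open>thom_convex\<close>,
  \<open>thom_order\<close>) makes the table superfluous: in a family closed under derivatives, each sign vector
  occurs on an interval or at a single point, and the vectors alone tell in which order these cells
  lie. So the mere set of sign vectors carries all the information, and the fibres over two parameters can be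
  compared by matching points with equal sign vectors.
\<close>

section \<open>Thom's lemma\<close>

lemma sgn_poly_diff:
  fixes p :: "real poly"
  assumes "a < b" and "\<And>v. a < v \<Longrightarrow> v < b \<Longrightarrow> sgn (poly (pderiv p) v) = s"
  shows "sgn (poly p b - poly p a) = s"
proof -
  obtain v where "a < v" "v < b" "poly p b - poly p a = (b - a) * poly (pderiv p) v"
    using poly_MVT[OF \<open>a < b\<close>] by blast
  then show ?thesis
    using assms by (simp add: sgn_mult)
qed

lemma sgn_between:
  fixes a b c :: real
  assumes "sgn a = sgn c" "sgn (b - a) = s" "sgn (c - b) = s"
  shows "sgn b = sgn a"
  using assms by (auto simp: sgn_if split: if_splits)

text \<open>
  This is the convexity half of Thom's lemma: the points at which \<open>p\<close> and all its derivatives have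
  prescribed signs form an interval. By induction on the degree the derivative has constant sign
  between two such points, so \<open>p\<close> is monotone (or constant) there, and a monotone function with the
  same sign at both ends has that sign in between.
\<close>

lemma thom_convex:
  fixes p :: "real poly"
  assumes "\<And>k. sgn (poly ((pderiv ^^ k) p) a) = sgn (poly ((pderiv ^^ k) p) c)"
    and "a \<le> b" "b \<le> c"
  shows "sgn (poly p b) = sgn (poly p a)"
  using assms
proof (induction "degree p" arbitrary: p b rule: less_induct)
  case less
  show ?case
  proof (cases "degree p = 0")
    case True
    then show ?thesis by (metis degree_0_id poly_pCons mult_zero_right poly_0 add_0_right)
  next
    case False
    have "sgn (poly (pderiv p) v) = sgn (poly (pderiv p) a)" if "a \<le> v" "v \<le> c" for v
    proof (rule less.hyps)
      show "degree (pderiv p) < degree p" using False by (simp add: degree_pderiv)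
      show "sgn (poly ((pderiv ^^ k) (pderiv p)) a) = sgn (poly ((pderiv ^^ k) (pderiv p)) c)" for k
        using less.prems(1)[of "Suc k"] by (simp only: funpow_Suc_right o_apply)
    qed (use that in auto)
    then have der: "sgn (poly (pderiv p) v) = sgn (poly (pderiv p) a)" if "a \<le> v" "v \<le> c" for v
      using that by blast
    have ac: "sgn (poly p a) = sgn (poly p c)"
      using less.prems(1)[of 0] by simp
    consider "b = a" | "b = c" | "a < b" "b < c" using less.prems by linarith
    then show ?thesis
    proof cases
      case 3
      have "sgn (poly p b - poly p a) = sgn (poly (pderiv p) a)"
        by (rule sgn_poly_diff[OF 3(1)]) (rule der, use 3 in auto)
      moreover have "sgn (poly p c - poly p b) = sgn (poly (pderiv p) a)"
        by (rule sgn_poly_diff[OF 3(2)]) (rule der, use 3 in auto)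
      ultimately show ?thesis by (rule sgn_between[OF ac])
    qed (simp_all add: ac)
  qed
qed

text \<open>
  The order half of Thom's lemma, stated contrapositively and for two polynomials at once because it
  is used to compare fibres over different parameters. At \<open>a\<close> and \<open>b\<close> the derivatives of \<open>p\<close> have
  the signs that those of \<open>q\<close> have at \<open>a'\<close> and \<open>b'\<close>. If some derivative distinguished \<open>a\<close> from \<open>b\<close>,
  the last one to do so would be strictly monotone, in a direction that its derivative prescribes for
  \<open>p\<close> and \<open>q\<close> alike; so \<open>a'\<close> and \<open>b'\<close> would have to lie in the same order as \<open>a\<close> and \<open>b\<close>.
\<close>

lemma thom_order:
  fixes p q :: "real poly"
  assumes "\<And>k. sgn (poly ((pderiv ^^ k) p) a) = sgn (poly ((pderiv ^^ k) q) a')"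
    and "\<And>k. sgn (poly ((pderiv ^^ k) p) b) = sgn (poly ((pderiv ^^ k) q) b')"
    and "a < b" "b' \<le> a'"
  shows "sgn (poly ((pderiv ^^ k) p) a) = sgn (poly ((pderiv ^^ k) p) b)"
  using assms(1,2)
proof (induction "degree p" arbitrary: p q k rule: less_induct)
  case less
  show ?case
  proof (cases "degree p = 0")
    case True
    then have "degree ((pderiv ^^ k) p) = 0" by (simp add: degree_higher_pderiv)
    then show ?thesis by (metis degree_0_id poly_pCons mult_zero_right poly_0 add_0_right)
  next
    case False
    have sh: "(pderiv ^^ j) (pderiv r) = (pderiv ^^ Suc j) r" for j and r :: "real poly"
      by (simp only: funpow_Suc_right o_apply)
    have *: "sgn (poly ((pderiv ^^ j) (pderiv p)) a) = sgn (poly ((pderiv ^^ j) (pderiv p)) b)" for j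
    proof (rule less.hyps[of "pderiv p" "pderiv q"])
      show "degree (pderiv p) < degree p" using False by (simp add: degree_pderiv)
      show "sgn (poly ((pderiv ^^ i) (pderiv p)) a) = sgn (poly ((pderiv ^^ i) (pderiv q)) a')" for i
        unfolding sh by (rule less.prems(1))
      show "sgn (poly ((pderiv ^^ i) (pderiv p)) b) = sgn (poly ((pderiv ^^ i) (pderiv q)) b')" for i
        unfolding sh by (rule less.prems(2))
    qed
    show ?thesis
    proof (cases k)
      case (Suc j)
      then show ?thesis using *[of j] sh by simp
    next
      case 0
      let ?s = "sgn (poly (pderiv p) a)"
      have "sgn (poly (pderiv p) v) = ?s" if "a < v" "v < b" for v
        using thom_convex[of "pderiv p" a b v] * that by simp
      then have p: "sgn (poly p b - poly p a) = ?s"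
        by (rule sgn_poly_diff[OF \<open>a < b\<close>])
      have **: "sgn (poly ((pderiv ^^ j) (pderiv q)) b') = sgn (poly ((pderiv ^^ j) (pderiv q)) a')" for j
        using *[of j] less.prems(1)[of "Suc j"] less.prems(2)[of "Suc j"] unfolding sh by metis
      have "sgn (poly (pderiv q) b') = ?s"
        using *[of 0] less.prems(2)[of "Suc 0"] by simp
      then have "sgn (poly (pderiv q) v) = ?s" if "b' < v" "v < a'" for v
        using thom_convex[of "pderiv q" b' a' v, OF **] that by simp
      then have q: "sgn (poly q a' - poly q b') = ?s" if "b' < a'"
        by (rule sgn_poly_diff[OF that])
      have "sgn (poly p a) = sgn (poly q a')" "sgn (poly p b) = sgn (poly q b')"
        using less.prems[of 0] by simp_all
      moreover have "b' = a' \<or> b' < a'" using assms(4) by auto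
      ultimately show ?thesis
        using p q 0 by (auto simp: sgn_if split: if_splits)
    qed
  qed
qed

lemma poly_unbounded:
  fixes p :: "real poly"
  assumes "degree p \<noteq> 0"
  obtains r where "\<And>v. r \<le> \<bar>v\<bar> \<Longrightarrow> B \<le> \<bar>poly p v\<bar>"
proof -
  obtain a q where p: "p = pCons a q" by (cases p)
  with assms have "q \<noteq> 0" by auto
  from poly_infinity[OF this, of B a] p that show ?thesis by auto
qed

text \<open>
  These two lemmas replace the leading coefficient as a source of information about infinity:
  on a ray where the derivative has constant sign, a nonconstant polynomial is monotone and
  unbounded, so its sign far out is known.
\<close>

lemma poly_left_end:
  fixes p :: "real poly"
  assumes "degree p \<noteq> 0" "\<bar>s\<bar> = 1" and "\<And>v. v \<le> b \<Longrightarrow> sgn (poly (pderiv p) v) = s"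
  shows "\<exists>v\<le>b. s * poly p v < 0"
proof -
  obtain r where r: "\<And>v. r \<le> \<bar>v\<bar> \<Longrightarrow> \<bar>poly p b\<bar> + 1 \<le> \<bar>poly p v\<bar>"
    using poly_unbounded[OF assms(1)] by metis
  define v where "v = min (b - 1) (- \<bar>r\<bar>)"
  have "v < b" "r \<le> \<bar>v\<bar>" unfolding v_def by linarith+
  from r[OF this(2)] sgn_poly_diff[OF \<open>v < b\<close>, of p s] assms(2,3)
  have "s * poly p v < 0" by (auto simp: sgn_if abs_if split: if_splits)
  then show ?thesis using \<open>v < b\<close> by (intro exI[of _ v]) auto
qed

lemma poly_right_end:
  fixes p :: "real poly"
  assumes "degree p \<noteq> 0" "\<bar>s\<bar> = 1" and "\<And>v. b \<le> v \<Longrightarrow> sgn (poly (pderiv p) v) = s"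
  shows "\<exists>v\<ge>b. s * poly p v > 0"
proof -
  obtain r where r: "\<And>v. r \<le> \<bar>v\<bar> \<Longrightarrow> \<bar>poly p b\<bar> + 1 \<le> \<bar>poly p v\<bar>"
    using poly_unbounded[OF assms(1)] by metis
  define v where "v = max (b + 1) \<bar>r\<bar>"
  have "b < v" "r \<le> \<bar>v\<bar>" unfolding v_def by linarith+
  from r[OF this(2)] sgn_poly_diff[OF \<open>b < v\<close>, of p s] assms(2,3)
  have "s * poly p v > 0" by (auto simp: sgn_if abs_if split: if_splits)
  then show ?thesis using \<open>b < v\<close> by (intro exI[of _ v]) auto
qed

section \<open>Signs of a monotone function on matching cells\<close>

lemma last_exit:
  fixes \<sigma> :: "real \<Rightarrow> 's"
  assumes "open {v. \<sigma> v = s}" "\<sigma> t = s" "\<sigma> b \<noteq> s" "b < t"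
  obtains a where "b \<le> a" "a < t" "\<sigma> a \<noteq> s" "\<And>v. a < v \<Longrightarrow> v \<le> t \<Longrightarrow> \<sigma> v = s"
proof -
  let ?B = "{..t} - {v. \<sigma> v = s}"
  define a where "a = Sup ?B"
  have b: "b \<in> ?B" using assms by auto
  have bdd: "bdd_above ?B" by (rule bdd_aboveI[of _ t]) auto
  have "a \<in> ?B" unfolding a_def
    using b bdd assms(1) by (intro closed_contains_Sup closed_Diff) auto
  moreover have "b \<le> a" unfolding a_def using b bdd by (rule cSup_upper)
  moreover have "v \<le> a" if "v \<in> ?B" for v unfolding a_def using that bdd by (rule cSup_upper)
  ultimately have "\<sigma> v = s" if "a < v" "v \<le> t" for v
    using that by (metis DiffI atMost_iff mem_Collect_eq not_le)
  moreover have "a \<noteq> t" "a \<le> t" "\<sigma> a \<noteq> s" using \<open>a \<in> ?B\<close> assms(2) by auto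
  ultimately show ?thesis using that[of a] \<open>b \<le> a\<close> by simp
qed

text \<open>
  Here \<open>\<sigma>\<close> and \<open>\<sigma>'\<close> stand for the sign vectors of one family of polynomials at two parameters, as
  functions on the line, and \<open>h\<close>, \<open>h'\<close> for one more polynomial at the same two parameters. The
  cell of \<open>s\<close> is an open interval bounded by roots of the family or by infinity; \<open>h\<close> is increasing
  on it, and the assumption \<open>boundary\<close> says that \<open>h\<close> and \<open>h'\<close> have the same signs at corresponding
  finite ends. This forces them to take the same signs on the two cells. Only the order of
  the line and the names of the cells enter, so the whole situation may be reflected at the origin,
  which is why \<open>boundary\<close> treats left and right ends alike and why polynomials are not mentioned.
\<close>

locale matching_cells =
  fixes \<sigma> \<sigma>' :: "real \<Rightarrow> 's" and s :: 's and h h' :: "real \<Rightarrow> real"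
  assumes partner: "\<exists>v'. \<sigma>' v' = \<sigma> v" and partner': "\<exists>v. \<sigma> v = \<sigma>' v'"
    and order: "\<sigma> a = \<sigma>' a' \<Longrightarrow> \<sigma> b = \<sigma>' b' \<Longrightarrow> \<sigma> a \<noteq> \<sigma> b \<Longrightarrow> a < b \<Longrightarrow> a' < b'"
    and open_cell: "open {v. \<sigma> v = s}" and open_cell': "open {v. \<sigma>' v = s}"
    and convex': "\<sigma>' a = s \<Longrightarrow> \<sigma>' b = s \<Longrightarrow> a < v \<Longrightarrow> v < b \<Longrightarrow> \<sigma>' v = s"
    and increasing: "a < b \<Longrightarrow> (\<And>v. a < v \<Longrightarrow> v < b \<Longrightarrow> \<sigma> v = s) \<Longrightarrow> h a < h b"
    and continuous': "continuous_on UNIV h'"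
    and left_end: "(\<And>v. v \<le> b \<Longrightarrow> \<sigma>' v = s) \<Longrightarrow> \<exists>v\<le>b. h' v < 0"
    and right_end: "(\<And>v. v \<ge> b \<Longrightarrow> \<sigma>' v = s) \<Longrightarrow> \<exists>v\<ge>b. h' v > 0"
    and boundary: "\<sigma> a = \<sigma>' a' \<Longrightarrow> \<sigma>' a' \<noteq> s \<Longrightarrow> \<sigma>' b' = s \<Longrightarrow>
      (\<And>v. min a' b' < v \<Longrightarrow> v < max a' b' \<Longrightarrow> \<sigma>' v = s) \<Longrightarrow> sgn (h a) = sgn (h' a')"
begin

text \<open>
  If \<open>h'\<close> were nonnegative on its cell, that cell could not extend to minus infinity, so it would
  have a left end \<open>a'\<close>. The left end \<open>a\<close> of the cell of \<open>h\<close> corresponds to \<open>a'\<close>, because cells are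
  ordered in the same way. Now \<open>h' a'\<close> is nonnegative by continuity, but \<open>h a\<close> lies below the
  negative value \<open>h t\<close>.
\<close>

lemma negative_value:
  assumes "\<sigma> t = s" "h t < 0"
  shows "\<exists>v. \<sigma>' v = s \<and> h' v < 0"
proof (rule ccontr)
  assume "\<not> ?thesis"
  then have nonneg: "h' v \<ge> 0" if "\<sigma>' v = s" for v using that by force
  obtain t' where t': "\<sigma>' t' = s" using partner[of t] assms by auto
  obtain b' where b': "b' < t'" "\<sigma>' b' \<noteq> s"
    using left_end[of t'] nonneg t' by (metis not_le order_less_le)
  obtain a' where a': "a' < t'" "\<sigma>' a' \<noteq> s" "\<And>v. a' < v \<Longrightarrow> v \<le> t' \<Longrightarrow> \<sigma>' v = s"
    using last_exit[OF open_cell' t' b'(2,1)] by metis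
  obtain b where b: "\<sigma> b = \<sigma>' a'" using partner' by blast
  have "b < t"
    using order[of t t' b a'] assms t' a' b by (metis less_asym linorder_neqE_linordered_idom)
  then obtain a where a: "b \<le> a" "a < t" "\<sigma> a \<noteq> s" "\<And>v. a < v \<Longrightarrow> v \<le> t \<Longrightarrow> \<sigma> v = s"
    using last_exit[OF open_cell assms(1), of b] a' b by metis
  \<comment> \<open>The left end \<open>a\<close> need not be the chosen partner \<open>b\<close> of \<open>a'\<close>, but they lie in one cell:
    a partner \<open>c'\<close> of \<open>a\<close> lies left of the cell of \<open>t'\<close>, hence not right of \<open>a'\<close>.\<close>
  obtain c' where c': "\<sigma>' c' = \<sigma> a" using partner by blast
  have "c' < t'" using order[of a c' t t'] a c' assms t' by simp
  then have "c' \<le> a'" using a'(3)[of c'] a(3) c' by force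
  have "\<sigma> a = \<sigma>' a'"
  proof (rule ccontr)
    assume "\<sigma> a \<noteq> \<sigma>' a'"
    then have "b < a" using a(1) b by (metis order_less_le)
    then have "a' < c'" using order[of b a' a c'] b c' \<open>\<sigma> a \<noteq> \<sigma>' a'\<close> by simp
    then show False using \<open>c' \<le> a'\<close> by simp
  qed
  then have "sgn (h a) = sgn (h' a')"
    using boundary[of a a' t'] a' t' by simp
  moreover have "h a < h t" using increasing[of a t] a by simp
  ultimately have "h' a' < 0" using assms(2) by (auto simp: sgn_if split: if_splits)
  have "(h' \<longlongrightarrow> h' a') (at_right a')"
    using continuous' by (auto simp: continuous_on_def intro: tendsto_within_subset)
  moreover have "\<forall>\<^sub>F v in at_right a'. 0 \<le> h' v"
    unfolding eventually_at_right_field using a' nonneg by (intro exI[of _ t']) auto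
  ultimately have "0 \<le> h' a'"
    by (intro tendsto_lowerbound[of h' _ "at_right a'"]) auto
  then show False using \<open>h' a' < 0\<close> by simp
qed

lemma positive_value:
  assumes "\<sigma> t = s" "h t > 0"
  shows "\<exists>v. \<sigma>' v = s \<and> h' v > 0"
proof -
  interpret reflected: matching_cells "\<lambda>v. \<sigma> (- v)" "\<lambda>v. \<sigma>' (- v)" s "\<lambda>v. - h (- v)" "\<lambda>v. - h' (- v)"
  proof
    have refl: "{v. \<tau> (- v) = s} = uminus ` {v. \<tau> v = s}" for \<tau> :: "real \<Rightarrow> 's"
      by (force simp: image_iff)
    show "open {v. \<sigma> (- v) = s}" "open {v. \<sigma>' (- v) = s}"
      unfolding refl using open_cell open_cell' by (auto intro: open_negations)
    show "\<exists>v'. \<sigma>' (- v') = \<sigma> (- v)" for v using partner by (metis minus_minus)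
    show "\<exists>v. \<sigma> (- v) = \<sigma>' (- v')" for v' using partner' by (metis minus_minus)
    show "a' < b'" if "\<sigma> (- a) = \<sigma>' (- a')" "\<sigma> (- b) = \<sigma>' (- b')" "\<sigma> (- a) \<noteq> \<sigma> (- b)" "a < b"
      for a b a' b' using order[of "-b" "-b'" "-a" "-a'"] that by simp
    show "\<sigma>' (- v) = s" if "\<sigma>' (- a) = s" "\<sigma>' (- b) = s" "a < v" "v < b" for a b v
      using convex'[of "-b" "-a" "-v"] that by simp
    show "- h (- a) < - h (- b)" if "a < b" "\<And>v. a < v \<Longrightarrow> v < b \<Longrightarrow> \<sigma> (- v) = s" for a b
      using increasing[of "-b" "-a"] that by (metis minus_less_iff neg_less_iff_less minus_minus)
    show "continuous_on UNIV (\<lambda>v. - h' (- v))"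
      by (intro continuous_intros continuous_on_compose2[OF continuous']) auto
    show "\<exists>v\<le>b. - h' (- v) < 0" if "\<And>v. v \<le> b \<Longrightarrow> \<sigma>' (- v) = s" for b
      using right_end[of "-b"] that by (metis minus_le_iff minus_minus neg_less_0_iff_less)
    show "\<exists>v\<ge>b. - h' (- v) > 0" if "\<And>v. v \<ge> b \<Longrightarrow> \<sigma>' (- v) = s" for b
      using left_end[of "-b"] that by (metis le_minus_iff minus_minus neg_0_less_iff_less)
    show "sgn (- h (- a)) = sgn (- h' (- a'))"
      if "\<sigma> (- a) = \<sigma>' (- a')" "\<sigma>' (- a') \<noteq> s" "\<sigma>' (- b') = s"
        "\<And>v. min a' b' < v \<Longrightarrow> v < max a' b' \<Longrightarrow> \<sigma>' (- v) = s" for a a' b'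
    proof -
      have "\<sigma>' v = s" if "min (- a') (- b') < v" "v < max (- a') (- b')" for v
        using \<open>\<And>v. min a' b' < v \<Longrightarrow> v < max a' b' \<Longrightarrow> \<sigma>' (- v) = s\<close>[of "- v"] that
        by (auto simp: min_def max_def split: if_splits)
      then have "sgn (h (- a)) = sgn (h' (- a'))"
        using boundary[of "-a" "-a'" "-b'"] that by blast
      then show ?thesis by (simp add: sgn_minus)
    qed
  qed
  show ?thesis
    using reflected.negative_value[of "- t"] assms by (metis minus_minus neg_less_0_iff_less)
qed

text \<open>
  A zero of \<open>h\<close> in the open cell has negative and positive values on its two sides, so the previous
  two lemmas and the intermediate value theorem produce a zero of \<open>h'\<close>.
\<close>

lemma same_sign:
  assumes "\<sigma> t = s"
  shows "\<exists>v. \<sigma>' v = s \<and> sgn (h' v) = sgn (h t)"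
proof -
  consider "h t < 0" | "h t > 0" | "h t = 0" by linarith
  then show ?thesis
  proof cases
    case 1
    then show ?thesis using negative_value[OF assms] by auto
  next
    case 2
    then show ?thesis using positive_value[OF assms] by auto
  next
    case 3
    obtain e where e: "e > 0" "\<And>v. \<bar>v - t\<bar> < e \<Longrightarrow> \<sigma> v = s"
      using open_cell assms unfolding open_dist by (auto simp: dist_real_def)
    have cell: "\<sigma> (t - e / 2) = s" "\<sigma> (t + e / 2) = s" using e by auto
    have "h (t - e / 2) < h t" "h t < h (t + e / 2)"
      using e by (auto intro!: increasing)
    then obtain v w where v: "\<sigma>' v = s" "h' v < 0" and w: "\<sigma>' w = s" "h' w > 0"
      using negative_value[OF cell(1)] positive_value[OF cell(2)] 3 by auto
    have cont: "continuous_on S h'" for S using continuous' continuous_on_subset by blast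
    have "\<exists>u. h' u = 0 \<and> (v < u \<and> u < w \<or> w < u \<and> u < v)"
    proof (cases "v < w")
      case True
      then obtain u where "v \<le> u" "u \<le> w" "h' u = 0" using IVT'[of h' v 0 w] v w cont by auto
      then show ?thesis using v w by (metis order_less_le order_less_irrefl)
    next
      case False
      then obtain u where "w \<le> u" "u \<le> v" "h' u = 0" using IVT2'[of h' v 0 w] v w cont by auto
      then show ?thesis using v w by (metis order_less_le order_less_irrefl)
    qed
    then obtain u where u: "h' u = 0" "v < u \<and> u < w \<or> w < u \<and> u < v" by blast
    then have "\<sigma>' u = s" using convex'[OF v(1) w(1)] convex'[OF w(1) v(1)] by blast
    then show ?thesis using u 3 by auto
  qed
qed

end

section \<open>Sign vectors of polynomials with parameters\<close>

text \<open>
  A polynomial in the variable \<open>t\<close> with parameters \<open>x\<close> is represented by the function that sends \<open>x\<close>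
  to the resulting real polynomial in \<open>t\<close>. A point of the total space is a pair of a parameter and
  a real number, and two points agree when the family has the same sign vector at them.
\<close>

definition agree :: "('p \<Rightarrow> real poly) set \<Rightarrow> 'p \<Rightarrow> real \<Rightarrow> 'p \<Rightarrow> real \<Rightarrow> bool" where
  "agree T x t y u \<longleftrightarrow> (\<forall>f\<in>T. sgn (poly (f x) t) = sgn (poly (f y) u))"

definition realizes :: "('p \<Rightarrow> real poly) set \<Rightarrow> 'p \<Rightarrow> 'p \<Rightarrow> bool" where
  "realizes T x y \<longleftrightarrow> (\<forall>t. \<exists>u. agree T x t y u)"

text \<open>
  Closure under derivatives makes Thom's lemma applicable. Closure under truncation is the way of
  dealing with leading coefficients that vanish for some parameters only: at each parameter every
  member coincides with one of its truncations whose formal degree is the true degree.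
\<close>

definition stable :: "('p \<Rightarrow> real poly) set \<Rightarrow> bool" where
  "stable T \<longleftrightarrow> (\<forall>f\<in>T. (\<lambda>x. pderiv (f x)) \<in> T \<and> (\<forall>e. (\<lambda>x. poly_cutoff e (f x)) \<in> T))"

lemma agree_sym: "agree T x t y u \<Longrightarrow> agree T y u x t"
  by (simp add: agree_def)

lemma agree_trans: "agree T x t y u \<Longrightarrow> agree T y u z v \<Longrightarrow> agree T x t z v"
  by (simp add: agree_def)

lemma agree_mono: "agree T x t y u \<Longrightarrow> S \<subseteq> T \<Longrightarrow> agree S x t y u"
  by (auto simp: agree_def)

lemma realizes_mono: "realizes T x y \<Longrightarrow> S \<subseteq> T \<Longrightarrow> realizes S x y"
  unfolding realizes_def by (meson agree_mono)

lemma stable_higher_pderiv: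
  assumes "stable T" "f \<in> T"
  shows "(\<lambda>x. (pderiv ^^ k) (f x)) \<in> T"
  using assms by (induction k) (auto simp: stable_def)

lemma agree_convex:
  assumes "stable T" "agree T x a x c" "a \<le> b" "b \<le> c"
  shows "agree T x b x a"
  unfolding agree_def
proof
  fix f assume "f \<in> T"
  show "sgn (poly (f x) b) = sgn (poly (f x) a)"
    using stable_higher_pderiv[OF assms(1) \<open>f \<in> T\<close>] assms(2)
    by (intro thom_convex[OF _ assms(3,4)]) (auto simp: agree_def)
qed

lemma agree_order:
  assumes "stable T" "agree T x a y a'" "agree T x b y b'" "\<not> agree T x a x b" "a < b"
  shows "a' < b'"
proof (rule ccontr)
  assume "\<not> a' < b'"
  then have "b' \<le> a'" by simp
  obtain f where "f \<in> T" "sgn (poly (f x) a) \<noteq> sgn (poly (f x) b)"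
    using assms(4) by (auto simp: agree_def)
  moreover have "sgn (poly ((pderiv ^^ 0) (f x)) a) = sgn (poly ((pderiv ^^ 0) (f x)) b)"
    using stable_higher_pderiv[OF assms(1) \<open>f \<in> T\<close>] assms(2,3)
    by (intro thom_order[OF _ _ assms(5) \<open>b' \<le> a'\<close>]) (auto simp: agree_def)
  ultimately show False by simp
qed

lemma poly_zero_interval:
  fixes p :: "real poly"
  assumes "a < b" "\<And>v. a < v \<Longrightarrow> v < b \<Longrightarrow> poly p v = 0"
  shows "p = 0"
proof (rule ccontr)
  assume "p \<noteq> 0"
  then have "finite {v. poly p v = 0}" by (rule poly_roots_finite)
  moreover have "{a<..<b} \<subseteq> {v. poly p v = 0}" using assms by auto
  ultimately show False using infinite_Ioo[OF assms(1)] finite_subset by blast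
qed

text \<open>
  A cell on which a nonzero member of the family vanishes is convex and contained in a finite set.
\<close>

lemma agree_singular:
  assumes "stable T" "f \<in> T" "f x \<noteq> 0" "poly (f x) a = 0" "agree T x a x b"
  shows "a = b"
proof -
  have *: False if "c < d" "agree T x c x d" "poly (f x) c = 0" for c d
  proof -
    have "poly (f x) v = 0" if "c < v" "v < d" for v
      using agree_convex[OF assms(1) \<open>agree T x c x d\<close>, of v] \<open>poly (f x) c = 0\<close> that assms(2)
      by (force simp: agree_def sgn_zero_iff)
    then show False using poly_zero_interval[OF \<open>c < d\<close>] assms(3) by blast
  qed
  have "poly (f x) b = 0" using assms by (force simp: agree_def sgn_zero_iff)
  then show ?thesis using *[of a b] *[of b a] agree_sym[OF assms(5)] assms(4,5)
    by (meson linorder_neqE_linordered_idom)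
qed

lemma open_regular_cell:
  assumes "finite T" "\<And>f. f \<in> T \<Longrightarrow> f x = 0 \<or> poly (f y) t \<noteq> 0"
    and "\<And>f. f \<in> T \<Longrightarrow> f x = 0 \<Longrightarrow> f y = 0"
  shows "open {v. agree T y v y t}"
proof -
  have "{v. agree T y v y t} = (\<Inter>f\<in>T. {v. sgn (poly (f y) v) = sgn (poly (f y) t)})"
    by (auto simp: agree_def)
  also have "open \<dots>"
  proof (intro open_INT assms(1) ballI)
    fix f assume f: "f \<in> T"
    consider "f y = 0" | "poly (f y) t > 0" | "poly (f y) t < 0" using assms f by force
    then show "open {v. sgn (poly (f y) v) = sgn (poly (f y) t)}"
    proof cases
      case 2
      then have "{v. sgn (poly (f y) v) = sgn (poly (f y) t)} = {v. poly (f y) v > 0}"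
        by (auto simp: sgn_if split: if_splits)
      then show ?thesis by (auto intro!: open_Collect_less continuous_intros)
    next
      case 3
      then have "{v. sgn (poly (f y) v) = sgn (poly (f y) t)} = {v. poly (f y) v < 0}"
        by (auto simp: sgn_if split: if_splits)
      then show ?thesis by (auto intro!: open_Collect_less continuous_intros)
    qed auto
  qed
  finally show ?thesis .
qed

text \<open>
  The ends of a cell lie outside it only because some member of the family has a root there: a
  nonzero sign cannot change between \<open>a\<close> and points arbitrarily close to \<open>a\<close> without a root.
\<close>

lemma boundary_singular:
  assumes "\<not> agree T x a x b" "\<And>v. min a b < v \<Longrightarrow> v < max a b \<Longrightarrow> agree T x v x b"
  obtains f where "f \<in> T" "f x \<noteq> 0" "poly (f x) a = 0"
proof -
  obtain f where f: "f \<in> T" "sgn (poly (f x) a) \<noteq> sgn (poly (f x) b)"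
    using assms(1) by (auto simp: agree_def)
  then have "a \<noteq> b" by auto
  have sg: "sgn (poly (f x) v) = sgn (poly (f x) b)" if "min a b < v" "v < max a b" for v
    using assms(2)[OF that] f by (simp add: agree_def)
  have "f x \<noteq> 0" using f by auto
  moreover have "poly (f x) b \<noteq> 0"
  proof
    assume "poly (f x) b = 0"
    then have "f x = 0"
      using poly_zero_interval[of "min a b" "max a b" "f x"] sg \<open>a \<noteq> b\<close> by (auto simp: sgn_zero_iff)
    with \<open>f x \<noteq> 0\<close> show False ..
  qed
  moreover have "poly (f x) a = 0"
  proof (rule ccontr)
    assume "poly (f x) a \<noteq> 0"
    then have neg: "poly (f x) a * poly (f x) b < 0"
      using f(2) \<open>poly (f x) b \<noteq> 0\<close> by (auto simp: sgn_if mult_less_0_iff split: if_splits)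
    obtain v where "min a b < v" "v < max a b" "poly (f x) v = 0"
    proof (cases "a < b")
      case True
      then show ?thesis using poly_IVT[OF True neg] that by auto
    next
      case False
      then have "b < a" using \<open>a \<noteq> b\<close> by simp
      then show ?thesis using poly_IVT[of b a "f x"] neg that by (auto simp: mult.commute)
    qed
    with sg[of v] \<open>poly (f x) b \<noteq> 0\<close> show False by (simp add: sgn_zero_iff)
  qed
  ultimately show ?thesis using that f by blast
qed

text \<open>
  The \<open>e\<close>-th derivative of a polynomial of degree at most \<open>e\<close> is \<open>fact e\<close> times its leading
  coefficient, so a family containing it also records whether that coefficient vanishes.
\<close>

lemma agree_coeff:
  assumes "agree T x t y u" "(\<lambda>z. (pderiv ^^ e) (q z)) \<in> T"
    and "degree (q x) \<le> e" "degree (q y) \<le> e"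
  shows "coeff (q x) e = 0 \<longleftrightarrow> coeff (q y) e = 0"
proof -
  have *: "poly ((pderiv ^^ e) r) v = fact e * coeff r e" if "degree r \<le> e" for r :: "real poly" and v
  proof -
    have "degree ((pderiv ^^ e) r) = 0" using that by (simp add: degree_higher_pderiv)
    then have "poly ((pderiv ^^ e) r) v = coeff ((pderiv ^^ e) r) 0"
      by (metis degree_0_id poly_pCons mult_zero_right poly_0 add_0_right coeff_pCons_0)
    then show ?thesis by (simp add: coeff_higher_pderiv pochhammer_fact)
  qed
  have "sgn (fact e * coeff (q x) e) = sgn (fact e * coeff (q y) e)"
    using assms *[of "q x" t] *[of "q y" u] unfolding agree_def by metis
  then show ?thesis by (simp add: sgn_mult sgn_zero_iff) (metis sgn_zero_iff)
qed

lemma poly_cutoff_idem: "degree p < e \<Longrightarrow> poly_cutoff e p = p"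
  by (rule poly_eqI) (auto simp: coeff_poly_cutoff coeff_eq_0)

lemma degree_poly_cutoff: "degree (poly_cutoff (Suc e) p) \<le> e"
  by (rule degree_le) (auto simp: coeff_poly_cutoff)

section \<open>Adding one polynomial to a family\<close>

text \<open>
  The members of \<open>G\<close> play the role of the remainders of \<open>p\<close> modulo the truncations of the members of
  \<open>T\<close>. Of a remainder only this matters: at the roots of the divisor it has the sign of \<open>p\<close>,
  provided that the formal leading coefficient of the divisor does not vanish.
\<close>

definition remainders :: "nat \<Rightarrow> ('p \<Rightarrow> real poly) \<Rightarrow> ('p \<Rightarrow> real poly) set \<Rightarrow> ('p \<Rightarrow> real poly) set \<Rightarrow> bool" where
  "remainders d p T G \<longleftrightarrow> (\<forall>f\<in>T. \<forall>e. 0 < e \<longrightarrow> e \<le> d \<longrightarrow> (\<exists>g\<in>G. \<forall>z t.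
      poly (poly_cutoff (Suc e) (f z)) t = 0 \<longrightarrow> coeff (f z) e \<noteq> 0 \<longrightarrow>
      sgn (poly (g z) t) = sgn (poly (p z) t)))"

text \<open>
  The truncation of \<open>f\<close> at its true degree over \<open>x\<close> has the root \<open>t\<close> there. By agreement its
  version over \<open>y\<close> has the root \<open>u\<close>, and its leading coefficient does not vanish either. So both
  signs of \<open>p\<close> are those of one remainder in \<open>G\<close>, which agree.
\<close>

lemma sgn_at_singular:
  assumes T: "stable T" "\<And>f z. f \<in> T \<Longrightarrow> degree (f z) \<le> d" and G: "remainders d p T G"
    and f: "f \<in> T" "f x \<noteq> 0" "poly (f x) t = 0"
    and u: "agree (T \<union> G) x t y u"
  shows "sgn (poly (p x) t) = sgn (poly (p y) u)"
proof -
  define e where "e = degree (f x)"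
  let ?q = "\<lambda>z. poly_cutoff (Suc e) (f z)"
  have "e \<noteq> 0"
  proof
    assume "e = 0"
    then obtain c where "f x = [:c:]" unfolding e_def by (metis degree_eq_zeroE)
    with f show False by simp
  qed
  have "e \<le> d" using T(2) f e_def by blast
  obtain g where g: "g \<in> G" "\<And>z t. poly (?q z) t = 0 \<Longrightarrow> coeff (f z) e \<noteq> 0 \<Longrightarrow>
      sgn (poly (g z) t) = sgn (poly (p z) t)"
    using G f(1) \<open>e \<noteq> 0\<close> \<open>e \<le> d\<close> unfolding remainders_def by blast
  have q: "?q \<in> T" using T(1) f(1) by (simp add: stable_def)
  have qx: "poly (?q x) t = 0" using f(3) by (simp add: poly_cutoff_idem e_def)
  have "sgn (poly (?q x) t) = sgn (poly (?q y) u)"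
    using u[unfolded agree_def, rule_format, of ?q] q by simp
  then have qy: "poly (?q y) u = 0" using qx by (simp add: sgn_zero_iff)
  have cx: "coeff (f x) e \<noteq> 0" using f(2) by (simp add: e_def)
  have cy: "coeff (f y) e \<noteq> 0"
    using agree_coeff[OF u, of e ?q] stable_higher_pderiv[OF T(1) q, of e] cx degree_poly_cutoff
    by (auto simp: coeff_poly_cutoff)
  have "sgn (poly (g x) t) = sgn (poly (g y) u)"
    using u g(1) by (simp add: agree_def)
  then show ?thesis using g(2)[OF qx cx] g(2)[OF qy cy] by simp
qed

text \<open>
  This is the step of the Cohen-Hoermander elimination. A point \<open>t\<close> over \<open>x\<close> has to be matched with
  one over \<open>y\<close> that has the same sign vector with respect to \<open>T\<close> and at which \<open>p\<close> has the same sign.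
  If the top coefficient of \<open>p\<close> vanishes over \<open>x\<close>, it does over \<open>y\<close> too, and \<open>p\<close> equals its truncation, which is in
  \<open>T\<close>. If \<open>t\<close> is a root of a member of \<open>T\<close>, the remainders decide. Otherwise \<open>t\<close> lies in an open cell
  of \<open>T\<close> on which the derivative of \<open>p\<close> has constant nonzero sign \<open>s\<close>, and \<open>s\<close> times \<open>p\<close> is
  increasing there, as in \<open>matching_cells\<close>.
\<close>

lemma realizes_insert:
  assumes T: "finite T" "stable T" "\<And>f z. f \<in> T \<Longrightarrow> degree (f z) \<le> d" and G: "remainders d p T G"
    and d: "0 < d" "\<And>z. degree (p z) \<le> d"
    and p: "(\<lambda>z. pderiv (p z)) \<in> T" "(\<lambda>z. poly_cutoff d (p z)) \<in> T"
    and xy: "realizes (T \<union> G) x y" "realizes (T \<union> G) y x"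
  shows "realizes (insert p T) x y"
  unfolding realizes_def
proof
  fix t
  have xy': "realizes T x y" "realizes T y x"
    by (rule realizes_mono[OF xy(1)], simp, rule realizes_mono[OF xy(2)], simp)
  obtain u where u: "agree T x t y u" using xy'(1) unfolding realizes_def by blast
  have singular: "sgn (poly (p z) a) = sgn (poly (p w) b)"
    if f: "f \<in> T" "f z \<noteq> 0" "poly (f z) a = 0" and ab: "agree (T \<union> G) z a w b" for f z w a b
    using T(2,3) G f ab by (rule sgn_at_singular)
  have extend: "\<exists>u. agree (insert p T) x t y u"
    if "agree T x t y u" "sgn (poly (p x) t) = sgn (poly (p y) u)" for u
    using that by (auto simp: agree_def)
  show "\<exists>u. agree (insert p T) x t y u"
  proof (cases "coeff (p x) d = 0")
    case True
    obtain e where e: "d = Suc e" using d(1) by (metis gr0_implies_Suc)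
    have "(\<lambda>z. (pderiv ^^ d) (p z)) \<in> T"
      using stable_higher_pderiv[OF T(2) p(1), of e] unfolding e funpow_Suc_right o_apply .
    then have "coeff (p y) d = 0" using agree_coeff[OF u, of d p] True d(2) by blast
    have cut: "poly_cutoff d (p z) = p z" if "coeff (p z) d = 0" for z
    proof (rule poly_eqI)
      fix i
      show "coeff (poly_cutoff d (p z)) i = coeff (p z) i"
        using that d(2)[of z] by (cases i d rule: linorder_cases) (auto simp: coeff_poly_cutoff coeff_eq_0)
    qed
    have "sgn (poly (poly_cutoff d (p x)) t) = sgn (poly (poly_cutoff d (p y)) u)"
      using u[unfolded agree_def, rule_format, OF p(2)] .
    then show ?thesis using extend[OF u] cut True \<open>coeff (p y) d = 0\<close> by simp
  next
    case cx: False
    show ?thesis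
    proof (cases "\<exists>f\<in>T. f x \<noteq> 0 \<and> poly (f x) t = 0")
      case True
      then obtain f where f: "f \<in> T" "f x \<noteq> 0" "poly (f x) t = 0" by blast
      obtain w where w: "agree (T \<union> G) x t y w" using xy(1) unfolding realizes_def by blast
      then show ?thesis
        using extend[of w] singular[OF f w] agree_mono[OF w, of T] by simp
    next
      case False
      then have reg: "f x = 0 \<or> poly (f x) t \<noteq> 0" if "f \<in> T" for f using that by blast
      have zero: "f y = 0" if f: "f \<in> T" "f x = 0" for f
      proof -
        have "poly (f y) v = 0" for v
        proof -
          obtain w where "agree T y v x w" using xy'(2) unfolding realizes_def by blast
          then show ?thesis using f by (auto simp: agree_def sgn_zero_iff)
        qed
        then show ?thesis using poly_all_0_iff_0 by blast
      qed
      have regy: "f x = 0 \<or> poly (f y) u \<noteq> 0" if "f \<in> T" for f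
        using reg[OF that] u that by (metis agree_def sgn_zero_iff)
      obtain e where e: "d = Suc e" using d(1) by (metis gr0_implies_Suc)
      have "(\<lambda>z. (pderiv ^^ d) (p z)) \<in> T"
        using stable_higher_pderiv[OF T(2) p(1), of e] unfolding e funpow_Suc_right o_apply .
      then have cy: "coeff (p y) d \<noteq> 0" using agree_coeff[OF u, of d p] cx d(2) by blast
      have degy: "degree (p y) \<noteq> 0" and degx: "degree (p x) \<noteq> 0"
        using cx cy d(1) le_degree by fastforce+
      define s where "s = sgn (poly (pderiv (p x)) t)"
      have "s \<noteq> 0" using reg[OF p(1)] degx by (simp add: s_def sgn_zero_iff pderiv_eq_0_iff)
      then have s: "\<bar>s\<bar> = 1" by (simp add: s_def sgn_if split: if_splits)
      \<comment> \<open>Sign vectors are cut off outside \<open>T\<close> so that their equality is agreement.\<close>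
      define \<sigma> where "\<sigma> = (\<lambda>z v f. if f \<in> T then sgn (poly (f z) v) else 0)"
      have \<sigma>: "\<sigma> z v = \<sigma> w v' \<longleftrightarrow> agree T z v w v'" for z w v v'
        by (auto simp: \<sigma>_def agree_def fun_eq_iff)
      have cell: "\<sigma> z v = \<sigma> x t \<longleftrightarrow> agree T z v x t" for z v by (rule \<sigma>)
      have sder: "sgn (poly (pderiv (p z)) v) = s" if "\<sigma> z v = \<sigma> x t" for z v
        using that[unfolded cell agree_def, rule_format, OF p(1)] unfolding s_def .
      have celly: "{v. \<sigma> y v = \<sigma> x t} = {v. agree T y v y u}"
        using u unfolding cell by (blast intro: agree_trans agree_sym)
      interpret matching_cells "\<sigma> x" "\<sigma> y" "\<sigma> x t" "\<lambda>v. s * poly (p x) v" "\<lambda>v. s * poly (p y) v"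
      proof
        show "\<exists>v'. \<sigma> y v' = \<sigma> x v" for v
          using xy'(1) unfolding realizes_def \<sigma> by (metis agree_sym)
        show "\<exists>v. \<sigma> x v = \<sigma> y v'" for v'
          using xy'(2) unfolding realizes_def \<sigma> by (metis agree_sym)
        show "a' < b'" if "\<sigma> x a = \<sigma> y a'" "\<sigma> x b = \<sigma> y b'" "\<sigma> x a \<noteq> \<sigma> x b" "a < b" for a b a' b'
          using agree_order[OF T(2)] that unfolding \<sigma> by blast
        show "open {v. \<sigma> x v = \<sigma> x t}"
          unfolding cell using T(1) reg by (rule open_regular_cell)
        show "open {v. \<sigma> y v = \<sigma> x t}"
          unfolding celly using T(1) regy zero by (rule open_regular_cell)
        show "\<sigma> y v = \<sigma> x t" if "\<sigma> y a = \<sigma> x t" "\<sigma> y b = \<sigma> x t" "a < v" "v < b" for a b v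
          using agree_convex[OF T(2), of y a b v] that \<sigma> by (metis less_imp_le)
        show "s * poly (p x) a < s * poly (p x) b"
          if "a < b" "\<And>v. a < v \<Longrightarrow> v < b \<Longrightarrow> \<sigma> x v = \<sigma> x t" for a b
        proof -
          have "sgn (poly (p x) b - poly (p x) a) = s"
            using sgn_poly_diff[OF that(1)] sder that(2) by metis
          then show ?thesis using s by (auto simp: sgn_if split: if_splits)
        qed
        show "continuous_on UNIV (\<lambda>v. s * poly (p y) v)" by (intro continuous_intros)
        show "\<exists>v\<le>b. s * poly (p y) v < 0" if "\<And>v. v \<le> b \<Longrightarrow> \<sigma> y v = \<sigma> x t" for b
          using poly_left_end[OF degy s] sder that by blast
        show "\<exists>v\<ge>b. s * poly (p y) v > 0" if "\<And>v. v \<ge> b \<Longrightarrow> \<sigma> y v = \<sigma> x t" for b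
          using poly_right_end[OF degy s] sder that by blast
        show "sgn (s * poly (p x) a) = sgn (s * poly (p y) a')"
          if a: "\<sigma> x a = \<sigma> y a'" "\<sigma> y a' \<noteq> \<sigma> x t" and b: "\<sigma> y b' = \<sigma> x t"
            "\<And>v. min a' b' < v \<Longrightarrow> v < max a' b' \<Longrightarrow> \<sigma> y v = \<sigma> x t" for a a' b'
        proof -
          \<comment> \<open>The point \<open>a'\<close> is a root of a member of \<open>T\<close>, so a partner \<open>w\<close> with respect to
            \<open>T \<union> G\<close> has the right sign of \<open>p\<close>; and \<open>w = a\<close>, since cells of roots are single points.\<close>
          have "\<not> agree T y a' y b'" "\<And>v. min a' b' < v \<Longrightarrow> v < max a' b' \<Longrightarrow> agree T y v y b'"
            using a b \<sigma> by metis+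
          then obtain f where f: "f \<in> T" "f y \<noteq> 0" "poly (f y) a' = 0"
            by (rule boundary_singular)
          obtain w where w: "agree (T \<union> G) y a' x w" using xy(2) unfolding realizes_def by blast
          have sw: "sgn (poly (p y) a') = sgn (poly (p x) w)"
            by (rule singular[OF f w])
          have "agree T x w y a'" using agree_sym[OF agree_mono[OF w]] by blast
          moreover have "agree T y a' x a" using a(1) \<sigma> by metis
          ultimately have wa: "agree T x w x a" by (rule agree_trans)
          have "f x \<noteq> 0" using zero f by blast
          moreover have "poly (f x) w = 0"
            using \<open>agree T x w y a'\<close> f by (metis agree_def sgn_zero_iff)
          ultimately have "w = a" using agree_singular[OF T(2) f(1) _ _ wa] by blast
          then show ?thesis using sw by (simp add: sgn_mult)
        qed
      qed
      obtain v where "\<sigma> y v = \<sigma> x t" "sgn (s * poly (p y) v) = sgn (s * poly (p x) t)"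
        using same_sign by blast
      then show ?thesis
        using \<open>s \<noteq> 0\<close> by (intro extend[of v]) (auto simp: sgn_mult sgn_zero_iff cell intro: agree_sym)
    qed
  qed
qed

section \<open>Elimination of one variable\<close>

definition param_poly :: "nat \<Rightarrow> ('a::euclidean_space \<Rightarrow> real poly) \<Rightarrow> bool" where
  "param_poly d f \<longleftrightarrow> (\<forall>x. degree (f x) \<le> d) \<and> (\<forall>i. real_polynomial_function (\<lambda>x. coeff (f x) i))"

lemma param_poly_mono: "param_poly d f \<Longrightarrow> d \<le> e \<Longrightarrow> param_poly e f"
  unfolding param_poly_def by (meson order_trans)

lemma param_poly_0: "param_poly d (\<lambda>_. 0)"
  by (auto simp: param_poly_def)

lemma param_poly_pderiv: "param_poly d f \<Longrightarrow> param_poly (d - 1) (\<lambda>x. pderiv (f x))"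
  by (auto simp: param_poly_def coeff_pderiv degree_pderiv diff_le_mono)

lemma param_poly_cutoff: "param_poly d f \<Longrightarrow> param_poly d (\<lambda>x. poly_cutoff e (f x))"
  unfolding param_poly_def
proof (intro conjI allI)
  fix i x assume f: "(\<forall>x. degree (f x) \<le> d) \<and> (\<forall>i. real_polynomial_function (\<lambda>x. coeff (f x) i))"
  then show "degree (poly_cutoff e (f x)) \<le> d"
    by (intro degree_le) (auto simp: coeff_poly_cutoff intro: coeff_eq_0 le_less_trans)
  show "real_polynomial_function (\<lambda>x. coeff (poly_cutoff e (f x)) i)"
    using f by (cases "i < e") (auto simp: coeff_poly_cutoff)
qed

lemma param_poly_cutoff_degree: "param_poly d f \<Longrightarrow> param_poly e (\<lambda>x. poly_cutoff (Suc e) (f x))"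
  using param_poly_cutoff[of d f "Suc e"] degree_poly_cutoff by (auto simp: param_poly_def)

text \<open>
  Members of \<open>A\<close> need only their derivative and the truncation that drops the coefficient of \<open>t ^ d\<close>
  in \<open>T\<close>: all shorter truncations are truncations of the latter, all longer ones change nothing.
\<close>

lemma stable_Un:
  assumes "stable T" "\<And>f. f \<in> A \<Longrightarrow> param_poly d f"
    and "\<And>f. f \<in> A \<Longrightarrow> (\<lambda>x. pderiv (f x)) \<in> T" "\<And>f. f \<in> A \<Longrightarrow> (\<lambda>x. poly_cutoff d (f x)) \<in> T"
  shows "stable (A \<union> T)"
  unfolding stable_def
proof (intro ballI conjI allI)
  fix f e assume f: "f \<in> A \<union> T"
  show "(\<lambda>x. pderiv (f x)) \<in> A \<union> T" using f assms(1,3) by (auto simp: stable_def)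
  show "(\<lambda>x. poly_cutoff e (f x)) \<in> A \<union> T"
  proof (cases "f \<in> T")
    case True
    then show ?thesis using assms(1) by (auto simp: stable_def)
  next
    case False
    then have A: "f \<in> A" using f by blast
    show ?thesis
    proof (cases "e \<le> d")
      case True
      have "(\<lambda>x. poly_cutoff e (poly_cutoff d (f x))) \<in> T"
        using assms(1) assms(4)[OF A] unfolding stable_def by fast
      moreover have "poly_cutoff e (poly_cutoff d p) = poly_cutoff e p" for p :: "real poly"
        using True by (intro poly_eqI) (auto simp: coeff_poly_cutoff)
      ultimately show ?thesis by simp
    next
      case False
      then have "poly_cutoff e (f x) = f x" for x
        using assms(2)[OF A] by (intro poly_cutoff_idem) (auto simp: param_poly_def intro: le_less_trans)
      then show ?thesis using A by simp
    qed
  qed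
qed

text \<open>
  Derivatives and proper truncations have smaller formal degree, so the closure process stops.
\<close>

lemma stable_closure:
  assumes "finite Q" "\<And>f. f \<in> Q \<Longrightarrow> param_poly d f"
  shows "\<exists>T. finite T \<and> Q \<subseteq> T \<and> stable T \<and> (\<forall>f\<in>T. param_poly d f)"
  using assms
proof (induction d arbitrary: Q)
  case 0
  have deg: "degree (f x) = 0" if "f \<in> Q" for f x
    using 0(2) that by (auto simp: param_poly_def)
  have "stable (insert (\<lambda>_. 0) Q)"
    unfolding stable_def
  proof (intro ballI conjI allI)
    fix f e assume f: "f \<in> insert (\<lambda>_. 0) Q"
    then have "(\<lambda>x. pderiv (f x)) = (\<lambda>_. 0)" using deg by (auto simp: pderiv_eq_0_iff fun_eq_iff)
    then show "(\<lambda>x. pderiv (f x)) \<in> insert (\<lambda>_. 0) Q" by simp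
    have "(\<lambda>x. poly_cutoff e (f x)) = (if e = 0 then (\<lambda>_. 0) else f)"
      using f deg by (auto simp: fun_eq_iff poly_eq_iff coeff_poly_cutoff coeff_eq_0)
    then show "(\<lambda>x. poly_cutoff e (f x)) \<in> insert (\<lambda>_. 0) Q" using f by auto
  qed
  then show ?case using 0 param_poly_0 by (intro exI[of _ "insert (\<lambda>_. 0) Q"]) auto
next
  case (Suc d)
  let ?Q = "(\<lambda>f x. pderiv (f x)) ` Q \<union> (\<lambda>f x. poly_cutoff (Suc d) (f x)) ` Q"
  have "param_poly d f" if "f \<in> ?Q" for f
    using that Suc.prems(2) param_poly_pderiv[of "Suc d"] param_poly_cutoff_degree by fastforce
  then obtain T where T: "finite T" "?Q \<subseteq> T" "stable T" "\<forall>f\<in>T. param_poly d f"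
    using Suc.IH[of ?Q] Suc.prems(1) by auto
  have "stable (Q \<union> T)"
    using T(2) by (intro stable_Un[where d = "Suc d"] T(3) Suc.prems(2)) auto
  moreover have "param_poly (Suc d) f" if "f \<in> Q \<union> T" for f
    using that T(4) Suc.prems(2) param_poly_mono[of d f "Suc d"] by auto
  ultimately show ?case
    using T(1) Suc.prems(1) by (intro exI[of _ "Q \<union> T"]) auto
qed

text \<open>
  Pseudo-division with the square of the leading coefficient \<open>c\<close> of the divisor as a multiplier: one
  step replaces \<open>p\<close> by \<open>c\<^sup>2 * p\<close> minus the multiple of \<open>q\<close> that cancels the top coefficient. The
  square keeps signs, and no quotient has to be recorded since \<open>q\<close> vanishes at the points in question.
\<close>

lemma pseudo_remainder:
  assumes "param_poly n p" "param_poly e q" "0 < e"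
  obtains g where "param_poly (e - 1) g"
    "\<And>z t. poly (q z) t = 0 \<Longrightarrow> coeff (q z) e \<noteq> 0 \<Longrightarrow> sgn (poly (g z) t) = sgn (poly (p z) t)"
  using assms(1)
proof (induction n arbitrary: p thesis)
  case 0
  then show ?case using param_poly_mono[of 0 p "e - 1"] by blast
next
  case (Suc n)
  show ?case
  proof (cases "Suc n < e")
    case True
    then have "param_poly (e - 1) p" using Suc.prems(2) by (auto intro: param_poly_mono)
    then show ?thesis using Suc.prems(1) by blast
  next
    case False
    let ?m = "Suc n - e"
    define r where "r = (\<lambda>z. smult ((coeff (q z) e)\<^sup>2) (p z)
      - monom (coeff (q z) e * coeff (p z) (Suc n)) ?m * q z)"
    have coeff_r: "coeff (r z) i = (coeff (q z) e)\<^sup>2 * coeff (p z) i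
      - (if i < ?m then 0 else coeff (q z) e * coeff (p z) (Suc n) * coeff (q z) (i - ?m))" for z i
      by (simp add: r_def coeff_monom_mult)
    have deg: "degree (p z) \<le> Suc n" "degree (q z) \<le> e" for z
      using Suc.prems(2) assms(2) by (auto simp: param_poly_def)
    have "degree (r z) \<le> n" for z
    proof (rule degree_le, intro allI impI)
      fix i assume "n < i"
      show "coeff (r z) i = 0"
      proof (cases "i = Suc n")
        case True
        then show ?thesis using False by (simp add: coeff_r power2_eq_square)
      next
        case i: False
        then have "coeff (p z) i = 0" "coeff (q z) (i - ?m) = 0"
          using deg[of z] \<open>n < i\<close> False by (auto intro!: coeff_eq_0)
        then show ?thesis by (simp add: coeff_r)
      qed
    qed
    moreover have "real_polynomial_function (\<lambda>z. coeff (r z) i)" for i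
      using Suc.prems(2) assms(2) unfolding coeff_r param_poly_def by (cases "i < ?m")
        (auto intro!: real_polynomial_function_diff real_polynomial_function.intros(4) real_polynomial_function_power)
    ultimately have "param_poly n r" by (simp add: param_poly_def)
    then obtain g where g: "param_poly (e - 1) g" "\<And>z t. poly (q z) t = 0 \<Longrightarrow> coeff (q z) e \<noteq> 0 \<Longrightarrow>
        sgn (poly (g z) t) = sgn (poly (r z) t)"
      using Suc.IH[of r] by blast
    have "sgn (poly (r z) t) = sgn (poly (p z) t)" if "poly (q z) t = 0" "coeff (q z) e \<noteq> 0" for z t
    proof -
      have "sgn ((coeff (q z) e)\<^sup>2) = 1" using that(2) by (intro sgn_pos) simp
      moreover have "poly (r z) t = (coeff (q z) e)\<^sup>2 * poly (p z) t" using that(1) by (simp add: r_def)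
      ultimately show ?thesis by (simp only: sgn_mult mult_1)
    qed
    then show ?thesis using g Suc.prems(1)[of g] by metis
  qed
qed

lemma exists_remainders:
  assumes "finite T" "\<And>f. f \<in> T \<Longrightarrow> param_poly (Suc d) f" "param_poly (Suc d) p"
  obtains G where "finite G" "\<And>g. g \<in> G \<Longrightarrow> param_poly d g" "remainders (Suc d) p T G"
proof -
  have "\<exists>g. param_poly d g \<and> (\<forall>z t. poly (poly_cutoff (Suc e) (f z)) t = 0 \<longrightarrow> coeff (f z) e \<noteq> 0 \<longrightarrow>
      sgn (poly (g z) t) = sgn (poly (p z) t))" if fe: "f \<in> T" "0 < e" "e \<le> Suc d" for f e
  proof -
    obtain g where "param_poly (e - 1) g" "\<And>z t. poly (poly_cutoff (Suc e) (f z)) t = 0 \<Longrightarrow>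
        coeff (poly_cutoff (Suc e) (f z)) e \<noteq> 0 \<Longrightarrow> sgn (poly (g z) t) = sgn (poly (p z) t)"
      using pseudo_remainder[OF assms(3) param_poly_cutoff_degree[OF assms(2)[OF fe(1)]] fe(2)] by blast
    then show ?thesis
      using fe param_poly_mono[of "e - 1" g d] by (intro exI[of _ g]) (auto simp: coeff_poly_cutoff)
  qed
  then obtain g where g: "\<And>f e. f \<in> T \<Longrightarrow> 0 < e \<Longrightarrow> e \<le> Suc d \<Longrightarrow> param_poly d (g f e) \<and>
      (\<forall>z t. poly (poly_cutoff (Suc e) (f z)) t = 0 \<longrightarrow> coeff (f z) e \<noteq> 0 \<longrightarrow>
      sgn (poly (g f e z) t) = sgn (poly (p z) t))"
    by metis
  show ?thesis
  proof (rule that[of "(\<lambda>(f, e). g f e) ` (T \<times> {0<..Suc d})"])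
    show "remainders (Suc d) p T ((\<lambda>(f, e). g f e) ` (T \<times> {0<..Suc d}))"
      unfolding remainders_def
    proof (intro ballI allI impI)
      fix f e assume fe: "f \<in> T" "0 < e" "e \<le> Suc d"
      then have "g f e \<in> (\<lambda>(f, e). g f e) ` (T \<times> {0<..Suc d})" by force
      then show "\<exists>h\<in>(\<lambda>(f, e). g f e) ` (T \<times> {0<..Suc d}). \<forall>z t.
          poly (poly_cutoff (Suc e) (f z)) t = 0 \<longrightarrow> coeff (f z) e \<noteq> 0 \<longrightarrow>
          sgn (poly (h z) t) = sgn (poly (p z) t)"
        using g[OF fe] by blast
    qed
  qed (use assms(1) g in auto)
qed

text \<open>
  The basic relation on the parameter space: a finite set of polynomial functions has the
  same sign vector at both points.
\<close>

definition same_signs :: "('a \<Rightarrow> real) set \<Rightarrow> 'a \<Rightarrow> 'a \<Rightarrow> bool" where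
  "same_signs C x y \<longleftrightarrow> (\<forall>c\<in>C. sgn (c x) = sgn (c y))"

lemma same_signs_sym: "same_signs C x y \<Longrightarrow> same_signs C y x"
  by (simp add: same_signs_def)

lemma same_signsD: "same_signs C x y \<Longrightarrow> c \<in> C \<Longrightarrow> sgn (c x) = sgn (c y)"
  by (simp add: same_signs_def)

text \<open>
  Quantifier elimination in a form without formulas and tables: over any two parameters at which
  finitely many polynomial functions have equal signs, the family takes the same sign vectors.
  Since \<open>same_signs\<close> is symmetric, inclusion in one direction is enough.
\<close>

definition sign_determined :: "('a::euclidean_space \<Rightarrow> real poly) set \<Rightarrow> bool" where
  "sign_determined Q \<longleftrightarrow> (\<exists>C. finite C \<and> (\<forall>c\<in>C. real_polynomial_function c) \<and>
     (\<forall>x y. same_signs C x y \<longrightarrow> realizes Q x y))"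

lemma sign_determined_mono: "sign_determined Q \<Longrightarrow> S \<subseteq> Q \<Longrightarrow> sign_determined S"
  unfolding sign_determined_def by (meson realizes_mono)

lemma sign_determined_insert:
  assumes T: "finite T" "stable T" "\<And>f. f \<in> T \<Longrightarrow> param_poly (Suc d) f"
    and G: "remainders (Suc d) p T G" and p: "param_poly (Suc d) p"
      "(\<lambda>z. pderiv (p z)) \<in> T" "(\<lambda>z. poly_cutoff (Suc d) (p z)) \<in> T"
    and "sign_determined (T \<union> G)"
  shows "sign_determined (insert p T)"
proof -
  obtain C where C: "finite C" "\<forall>c\<in>C. real_polynomial_function c"
    and real: "\<And>x y. same_signs C x y \<Longrightarrow> realizes (T \<union> G) x y"
    using assms(8) unfolding sign_determined_def by blast
  have deg: "degree (f z) \<le> Suc d" if "f \<in> T" for f z using T(3)[OF that] by (simp add: param_poly_def)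
  have degp: "degree (p z) \<le> Suc d" for z using p(1) by (simp add: param_poly_def)
  have "realizes (insert p T) x y" if xy: "same_signs C x y" for x y
    using T(1,2) deg G zero_less_Suc degp p(2,3) real[OF xy] real[OF same_signs_sym[OF xy]]
    by (rule realizes_insert)
  then show ?thesis using C unfolding sign_determined_def by blast
qed

text \<open>
  The induction is on the degree bound \<open>d\<close>. Constant families are their own witnesses. For the step,
  the polynomials of formal degree \<open>d + 1\<close>, collected in \<open>A\<close>, are added one by one to a stable family
  \<open>T\<close> of degree at most \<open>d\<close>. Adding \<open>p\<close> requires the remainders of \<open>p\<close> modulo all of \<open>A \<union> T\<close>,
  but these have degree at most \<open>d\<close>, so they can be absorbed into \<open>T\<close>. This is why the inner claim
  must hold for all \<open>T\<close>.
\<close>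

theorem sign_determined_finite:
  fixes Q :: "('a::euclidean_space \<Rightarrow> real poly) set"
  assumes "finite Q" "\<And>f. f \<in> Q \<Longrightarrow> param_poly d f"
  shows "sign_determined Q"
  using assms
proof (induction d arbitrary: Q)
  case 0
  have const: "poly (f x) t = coeff (f x) 0" if "f \<in> Q" for f x t
  proof -
    have "degree (f x) = 0" using 0(2)[of f] that by (auto simp: param_poly_def)
    then obtain c where "f x = [:c:]" by (rule degree_eq_zeroE)
    then show ?thesis by simp
  qed
  let ?C = "(\<lambda>f x. coeff (f x) 0) ` Q"
  have "realizes Q x y" if "same_signs ?C x y" for x y
    using that const by (auto simp: realizes_def agree_def same_signs_def)
  moreover have "finite ?C" "\<forall>c\<in>?C. real_polynomial_function c"
    using 0 by (auto simp: param_poly_def)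
  ultimately show ?case unfolding sign_determined_def by blast
next
  case (Suc d)
  have main: "sign_determined (A \<union> T)"
    if "finite A" "\<And>f. f \<in> A \<Longrightarrow> param_poly (Suc d) f"
      "finite T" "stable T" "\<And>f. f \<in> T \<Longrightarrow> param_poly d f"
      "\<And>f. f \<in> A \<Longrightarrow> (\<lambda>x. pderiv (f x)) \<in> T"
      "\<And>f. f \<in> A \<Longrightarrow> (\<lambda>x. poly_cutoff (Suc d) (f x)) \<in> T" for A T :: "('a \<Rightarrow> real poly) set"
    using that
  proof (induction A arbitrary: T rule: finite_induct)
    case empty
    then show ?case using Suc.IH[of T] by simp
  next
    case (insert p A)
    let ?T = "A \<union> T"
    have T: "finite ?T" "stable ?T" "\<And>f. f \<in> ?T \<Longrightarrow> param_poly (Suc d) f"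
    proof -
      show "stable ?T"
        using insert.prems(5,6) by (intro stable_Un[where d = "Suc d"] insert.prems(1,3)) auto
      show "param_poly (Suc d) f" if "f \<in> ?T" for f
        using that insert.prems(1,4) param_poly_mono[of d f "Suc d"] by auto
    qed (use insert in auto)
    have p: "param_poly (Suc d) p" using insert.prems(1) by simp
    obtain G where G: "finite G" "\<And>g. g \<in> G \<Longrightarrow> param_poly d g" "remainders (Suc d) p ?T G"
      using exists_remainders[OF T(1,3) p] by blast
    obtain T' where T': "finite T'" "T \<union> G \<subseteq> T'" "stable T'" "\<forall>f\<in>T'. param_poly d f"
      using stable_closure[of "T \<union> G" d] insert.prems(2,4) G(1,2) by auto
    have "sign_determined (A \<union> T')"
      using insert.prems(1,5,6) T' by (intro insert.IH) auto
    then have "sign_determined (?T \<union> G)"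
      using T'(2) by (elim sign_determined_mono) blast
    moreover have "(\<lambda>z. pderiv (p z)) \<in> ?T" "(\<lambda>z. poly_cutoff (Suc d) (p z)) \<in> ?T"
      using insert.prems(5,6) by blast+
    ultimately have "sign_determined (insert p ?T)"
      by (intro sign_determined_insert[OF T G(3) p])
    then show ?case by simp
  qed
  let ?Q = "(\<lambda>f x. pderiv (f x)) ` Q \<union> (\<lambda>f x. poly_cutoff (Suc d) (f x)) ` Q"
  have "param_poly d f" if "f \<in> ?Q" for f
    using that Suc.prems(2) param_poly_pderiv[of "Suc d"] param_poly_cutoff_degree by fastforce
  then obtain T where T: "finite T" "?Q \<subseteq> T" "stable T" "\<forall>f\<in>T. param_poly d f"
    using stable_closure[of ?Q d] Suc.prems(1) by auto
  have "sign_determined (Q \<union> T)"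
    using T(2,4) by (intro main Suc.prems T(1,3)) auto
  then show ?case by (rule sign_determined_mono) simp
qed

section \<open>Semialgebraic sets and their projections\<close>

text \<open>
  A union of finitely many basic sets depends only on the signs of all polynomials involved.
  Conversely, a set that depends only on the signs of \<open>C\<close> is the union of its sign classes; there
  are at most \<open>3 ^ card C\<close> of them, and each of them is basic. With this description, complements, intersections
  and preimages need no manipulation of normal forms.
\<close>

lemma semialgebraic_iff_same_signs:
  "semialgebraic S \<longleftrightarrow> (\<exists>C. finite C \<and> (\<forall>c\<in>C. real_polynomial_function c) \<and>
     (\<forall>x y. same_signs C x y \<longrightarrow> x \<in> S \<longrightarrow> y \<in> S))" (is "_ \<longleftrightarrow> ?rhs")
proof
  assume "semialgebraic S"
  then obtain \<B> where \<B>: "finite \<B>" "\<And>B. B \<in> \<B> \<Longrightarrow> basic_semialgebraic B" "S = \<Union>\<B>"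
    unfolding semialgebraic_def by blast
  have "\<exists>C. finite C \<and> (\<forall>c\<in>C. real_polynomial_function c) \<and>
      (\<forall>x y. same_signs C x y \<longrightarrow> x \<in> B \<longrightarrow> y \<in> B)" if B: "B \<in> \<B>" for B
  proof -
    obtain E L where EL: "finite E" "finite L" "\<forall>f\<in>E. real_polynomial_function f"
      "\<forall>g\<in>L. real_polynomial_function g" "B = {x. (\<forall>f\<in>E. f x = 0) \<and> (\<forall>g\<in>L. g x < 0)}"
      using \<B>(2)[OF B] unfolding basic_semialgebraic_def by blast
    have "a = 0 \<longleftrightarrow> b = 0" "a < 0 \<longleftrightarrow> b < 0" if "sgn a = sgn b" for a b :: real
      using that by (auto simp: sgn_if split: if_splits)
    then have "y \<in> B" if "same_signs (E \<union> L) x y" "x \<in> B" for x y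
      using that unfolding EL(5) same_signs_def by blast
    then show ?thesis using EL(1-4) by (intro exI[of _ "E \<union> L"]) auto
  qed
  then have "\<forall>B\<in>\<B>. \<exists>C. finite C \<and> (\<forall>c\<in>C. real_polynomial_function c) \<and>
      (\<forall>x y. same_signs C x y \<longrightarrow> x \<in> B \<longrightarrow> y \<in> B)" by blast
  from bchoice[OF this] obtain C where C: "\<forall>B\<in>\<B>. finite (C B) \<and>
      (\<forall>c\<in>C B. real_polynomial_function c) \<and> (\<forall>x y. same_signs (C B) x y \<longrightarrow> x \<in> B \<longrightarrow> y \<in> B)" ..
  have "y \<in> S" if xy: "same_signs (\<Union>(C ` \<B>)) x y" and x: "x \<in> S" for x y
  proof -
    obtain B where B: "B \<in> \<B>" "x \<in> B" using x \<B>(3) by blast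
    then have "same_signs (C B) x y" using xy by (auto simp: same_signs_def)
    then have "y \<in> B" using C B by blast
    then show ?thesis using \<B>(3) B(1) by blast
  qed
  then show ?rhs using \<B>(1) C by (intro exI[of _ "\<Union>(C ` \<B>)"]) auto
next
  assume ?rhs
  then obtain C where C: "finite C" "\<And>c. c \<in> C \<Longrightarrow> real_polynomial_function c"
    and S: "\<And>x y. same_signs C x y \<Longrightarrow> x \<in> S \<Longrightarrow> y \<in> S" by blast
  define cell where "cell = (\<lambda>x. {y. same_signs C x y})"
  have "cell ` S \<subseteq> (\<lambda>\<tau>. {y. \<forall>c\<in>C. \<tau> c = sgn (c y)}) ` (C \<rightarrow>\<^sub>E {-1, 0, 1})"
  proof
    fix B assume "B \<in> cell ` S"
    then obtain x where "B = cell x" by blast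
    then have "B = (\<lambda>\<tau>. {y. \<forall>c\<in>C. \<tau> c = sgn (c y)}) (restrict (\<lambda>c. sgn (c x)) C)"
      by (auto simp: cell_def same_signs_def)
    moreover have "restrict (\<lambda>c. sgn (c x)) C \<in> C \<rightarrow>\<^sub>E {-1, 0, 1}"
      by (auto simp: sgn_if)
    ultimately show "B \<in> (\<lambda>\<tau>. {y. \<forall>c\<in>C. \<tau> c = sgn (c y)}) ` (C \<rightarrow>\<^sub>E {-1, 0, 1})" by blast
  qed
  then have "finite (cell ` S)"
    by (rule finite_subset) (simp add: C(1) finite_PiE)
  moreover have "basic_semialgebraic (cell x)" for x
    unfolding basic_semialgebraic_def
  proof (intro exI conjI)
    let ?E = "{c \<in> C. c x = 0}" and ?L = "{c \<in> C. c x < 0} \<union> (\<lambda>c y. - c y) ` {c \<in> C. c x > 0}"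
    show "finite ?E" "finite ?L" "\<forall>f\<in>?E. real_polynomial_function f" "\<forall>f\<in>?L. real_polynomial_function f"
      using C by auto
    have sgn_eq: "sgn a = sgn b \<longleftrightarrow> (a = 0 \<longrightarrow> b = 0) \<and> (a < 0 \<longrightarrow> b < 0) \<and> (a > 0 \<longrightarrow> - b < 0)"
      for a b :: real by (auto simp: sgn_if)
    show "cell x = {y. (\<forall>f\<in>?E. f y = 0) \<and> (\<forall>g\<in>?L. g y < 0)}"
      unfolding cell_def same_signs_def sgn_eq ball_Un ball_simps by blast
  qed
  moreover have "S = \<Union> (cell ` S)"
    using S by (auto simp: cell_def) (auto simp: same_signs_def)
  ultimately show "semialgebraic S" unfolding semialgebraic_def by blast
qed

lemma semialgebraicI:
  assumes "finite C" "\<And>c. c \<in> C \<Longrightarrow> real_polynomial_function c"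
    and "\<And>x y. same_signs C x y \<Longrightarrow> x \<in> S \<Longrightarrow> y \<in> S"
  shows "semialgebraic S"
  unfolding semialgebraic_iff_same_signs
proof (intro exI conjI ballI allI impI)
  show "finite C" by (rule assms(1))
qed (fact assms(2), fact assms(3))

lemma semialgebraic_Compl:
  assumes "semialgebraic S"
  shows "semialgebraic (- S)"
proof -
  obtain C where "finite C" "\<And>c. c \<in> C \<Longrightarrow> real_polynomial_function c"
    "\<And>x y. same_signs C x y \<Longrightarrow> x \<in> S \<Longrightarrow> y \<in> S"
    using assms unfolding semialgebraic_iff_same_signs by blast
  then show ?thesis by (intro semialgebraicI[of C]) (auto dest: same_signs_sym)
qed

lemma semialgebraic_Int:
  assumes "semialgebraic S" "semialgebraic T"
  shows "semialgebraic (S \<inter> T)"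
proof -
  obtain C where C: "finite C" "\<And>c. c \<in> C \<Longrightarrow> real_polynomial_function c"
    "\<And>x y. same_signs C x y \<Longrightarrow> x \<in> S \<Longrightarrow> y \<in> S"
    using assms(1) unfolding semialgebraic_iff_same_signs by blast
  obtain D where D: "finite D" "\<And>c. c \<in> D \<Longrightarrow> real_polynomial_function c"
    "\<And>x y. same_signs D x y \<Longrightarrow> x \<in> T \<Longrightarrow> y \<in> T"
    using assms(2) unfolding semialgebraic_iff_same_signs by blast
  show ?thesis
  proof (rule semialgebraicI[of "C \<union> D"])
    fix x y assume "same_signs (C \<union> D) x y" and x: "x \<in> S \<inter> T"
    then have "same_signs C x y" "same_signs D x y" by (simp_all add: same_signs_def)
    then show "y \<in> S \<inter> T" using C(3) D(3) x by simp
  qed (use C D in auto)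
qed

lemma semialgebraic_vimage:
  assumes "semialgebraic S" "polynomial_function h"
  shows "semialgebraic (h -` S)"
proof -
  obtain C where C: "finite C" "\<And>c. c \<in> C \<Longrightarrow> real_polynomial_function c"
    "\<And>x y. same_signs C x y \<Longrightarrow> x \<in> S \<Longrightarrow> y \<in> S"
    using assms(1) unfolding semialgebraic_iff_same_signs by blast
  show ?thesis
  proof (rule semialgebraicI[of "(\<lambda>c. c \<circ> h) ` C"])
    show "y \<in> h -` S" if "same_signs ((\<lambda>c. c \<circ> h) ` C) x y" "x \<in> h -` S" for x y
      using that C(3)[of "h x" "h y"] by (auto simp: same_signs_def)
  qed (use C assms(2) in auto)
qed

lemma semialgebraic_negative:
  assumes "real_polynomial_function f"
  shows "semialgebraic {x. f x < 0}"
proof (rule semialgebraicI[of "{f}"])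
  fix x y assume "same_signs {f} x y" "x \<in> {x. f x < 0}"
  then have "sgn (f x) = sgn (f y)" "sgn (f x) = -1" by (simp_all add: same_signs_def)
  then show "y \<in> {x. f x < 0}" by (simp add: sgn_if split: if_splits)
qed (use assms in simp_all)

lemma real_polynomial_function_along_line:
  assumes "real_polynomial_function g"
  obtains d f where "param_poly d f" "\<And>x t. poly (f x) t = g (x + t *\<^sub>R v)"
proof -
  have "\<exists>d f. param_poly d f \<and> (\<forall>x t. poly (f x) t = g (x + t *\<^sub>R v))"
    using assms
  proof (induction g rule: real_polynomial_function.induct)
    case (linear h)
    have "param_poly 1 (\<lambda>x. [:h x, h v:])"
      using linear unfolding param_poly_def
    proof (intro conjI allI)
      show "real_polynomial_function (\<lambda>x. coeff [:h x, h v:] i)" for i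
        using linear by (cases i; cases "i - 1") (auto simp: coeff_pCons)
    qed auto
    moreover have "poly [:h x, h v:] t = h (x + t *\<^sub>R v)" for x t
      using bounded_linear.linear[OF linear] by (simp add: linear_add linear_scale)
    ultimately show ?case by blast
  next
    case (const c)
    have "param_poly 0 (\<lambda>_. [:c:])"
      unfolding param_poly_def by (auto simp: coeff_pCons split: nat.splits)
    then show ?case by (intro exI[of _ 0] exI[of _ "\<lambda>_. [:c:]"]) auto
  next
    case (add g1 g2)
    then obtain d1 f1 d2 f2 where f: "param_poly d1 f1" "\<forall>x t. poly (f1 x) t = g1 (x + t *\<^sub>R v)"
      "param_poly d2 f2" "\<forall>x t. poly (f2 x) t = g2 (x + t *\<^sub>R v)" by blast
    then have "param_poly (max d1 d2) (\<lambda>x. f1 x + f2 x)"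
      unfolding param_poly_def by (auto intro!: degree_add_le) (auto simp: le_max_iff_disj)
    then show ?case
      using f by (intro exI[of _ "max d1 d2"] exI[of _ "\<lambda>x. f1 x + f2 x"]) simp
  next
    case (mult g1 g2)
    then obtain d1 f1 d2 f2 where f: "param_poly d1 f1" "\<forall>x t. poly (f1 x) t = g1 (x + t *\<^sub>R v)"
      "param_poly d2 f2" "\<forall>x t. poly (f2 x) t = g2 (x + t *\<^sub>R v)" by blast
    have "param_poly (d1 + d2) (\<lambda>x. f1 x * f2 x)"
      unfolding param_poly_def
    proof (intro conjI allI)
      show "degree (f1 x * f2 x) \<le> d1 + d2" for x
        using f(1,3) by (meson add_mono degree_mult_le order_trans param_poly_def)
      show "real_polynomial_function (\<lambda>x. coeff (f1 x * f2 x) i)" for i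
        unfolding coeff_mult using f(1,3)
        by (intro real_polynomial_function_sum real_polynomial_function.intros(4)) (auto simp: param_poly_def)
    qed
    then show ?case
      using f by (intro exI[of _ "d1 + d2"] exI[of _ "\<lambda>x. f1 x * f2 x"]) simp
  qed
  then show ?thesis using that by blast
qed

text \<open>
  On the lines in direction \<open>v\<close> the polynomials that describe \<open>S\<close> become polynomials in \<open>t\<close> with the
  base point \<open>x\<close> as a parameter. Whether such a line meets \<open>S\<close> depends only on the sign vectors
  that these take on it, hence on finitely many polynomial signs at \<open>x\<close>. Working
  with directions instead of coordinates keeps all sets in one space.
\<close>

lemma semialgebraic_sweep:
  assumes "semialgebraic S"
  shows "semialgebraic {x. \<exists>t. x + t *\<^sub>R v \<in> S}"
proof -
  obtain C where C: "finite C" "\<And>c. c \<in> C \<Longrightarrow> real_polynomial_function c"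
    and S: "\<And>x y. same_signs C x y \<Longrightarrow> x \<in> S \<Longrightarrow> y \<in> S"
    using assms unfolding semialgebraic_iff_same_signs by blast
  have "\<forall>c\<in>C. \<exists>d f. param_poly d f \<and> (\<forall>x t. poly (f x) t = c (x + t *\<^sub>R v))"
    using C(2) real_polynomial_function_along_line by metis
  then obtain d f where f: "\<And>c. c \<in> C \<Longrightarrow> param_poly (d c) (f c)"
    "\<And>c x t. c \<in> C \<Longrightarrow> poly (f c x) t = c (x + t *\<^sub>R v)" by metis
  have "param_poly (sum d C) g" if "g \<in> f ` C" for g
    using that f(1) C(1) by (auto intro: param_poly_mono member_le_sum)
  then have "sign_determined (f ` C)"
    using C(1) by (intro sign_determined_finite[where d = "sum d C"]) auto
  then obtain D where D: "finite D" "\<And>c. c \<in> D \<Longrightarrow> real_polynomial_function c"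
    "\<And>x y. same_signs D x y \<Longrightarrow> realizes (f ` C) x y"
    unfolding sign_determined_def by blast
  show ?thesis
  proof (rule semialgebraicI[OF D(1,2)])
    fix x y assume xy: "same_signs D x y" and "x \<in> {x. \<exists>t. x + t *\<^sub>R v \<in> S}"
    then obtain t where t: "x + t *\<^sub>R v \<in> S" by blast
    obtain u where "agree (f ` C) x t y u" using D(3)[OF xy] unfolding realizes_def by blast
    then have "same_signs C (x + t *\<^sub>R v) (y + u *\<^sub>R v)"
      unfolding agree_def same_signs_def using f(2) by fastforce
    then show "y \<in> {x. \<exists>t. x + t *\<^sub>R v \<in> S}" using S t by blast
  qed
qed

lemma semialgebraic_sweep_span:
  assumes "finite B" "semialgebraic S"
  shows "semialgebraic {x. \<exists>v\<in>span B. x + v \<in> S}"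
  using assms(1)
proof (induction B)
  case empty
  then show ?case using assms(2) by simp
next
  case (insert b B)
  have "{x. \<exists>v\<in>span (insert b B). x + v \<in> S} = {x. \<exists>t. x + t *\<^sub>R b \<in> {x. \<exists>v\<in>span B. x + v \<in> S}}"
    (is "?L = ?R")
  proof
    show "?L \<subseteq> ?R"
    proof
      fix x assume "x \<in> ?L"
      then obtain v where v: "v \<in> span (insert b B)" "x + v \<in> S" by blast
      then obtain t where "v - t *\<^sub>R b \<in> span B" by (auto simp: span_breakdown_eq)
      moreover have "x + t *\<^sub>R b + (v - t *\<^sub>R b) \<in> S" using v by simp
      ultimately show "x \<in> ?R" by blast
    qed
    show "?R \<subseteq> ?L"
    proof
      fix x assume "x \<in> ?R"
      then obtain t v where "v \<in> span B" "x + t *\<^sub>R b + v \<in> S" by blast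
      then have "t *\<^sub>R b + v \<in> span (insert b B)" "x + (t *\<^sub>R b + v) \<in> S"
        by (auto simp: span_breakdown_eq add.assoc intro!: exI[of _ t])
      then show "x \<in> ?L" by blast
    qed
  qed
  then show ?case using semialgebraic_sweep[OF insert.IH] by simp
qed

text \<open>
  The Tarski-Seidenberg theorem: sweep \<open>W\<close> along the subspace \<open>{0} \<times> UNIV\<close>, one basis vector at a
  time, and intersect the result with the slice where the second component is \<open>0\<close>.
\<close>

theorem semialgebraic_projection:
  fixes W :: "('a::euclidean_space \<times> 'b::euclidean_space) set"
  assumes "semialgebraic W"
  shows "semialgebraic {z. \<exists>y. (z, y) \<in> W}"
proof -
  let ?V = "range (Pair 0) :: ('a \<times> 'b) set"
  have lin: "linear (Pair 0 :: 'b \<Rightarrow> 'a \<times> 'b)" by (intro linearI) auto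
  have V: "span (Pair 0 ` Basis) = ?V"
    using linear_span_image[OF lin, of Basis] by simp
  have "semialgebraic {x. \<exists>v\<in>?V. x + v \<in> W}"
    using semialgebraic_sweep_span[of "Pair 0 ` Basis" W] assms unfolding V by simp
  moreover have "polynomial_function (\<lambda>z. (z, 0) :: 'a \<times> 'b)"
    by (intro polynomial_function_bounded_linear bounded_linear_intros)
  ultimately have "semialgebraic ((\<lambda>z. (z, 0)) -` {x. \<exists>v\<in>?V. x + v \<in> W})"
    by (rule semialgebraic_vimage)
  moreover have "(\<lambda>z. (z, 0)) -` {x. \<exists>v\<in>?V. x + v \<in> W} = {z. \<exists>y. (z, y) \<in> W}"
    by auto
  ultimately show ?thesis by simp
qed

section \<open>The graph of the basic multifunction\<close>

lemma semialgebraic_std_simplex: "semialgebraic (std_simplex :: (real ^ 'm::finite) set)"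
proof (rule semialgebraicI)
  let ?C = "insert (\<lambda>\<xi>. (\<Sum>l\<in>UNIV. \<xi> $ l) - 1) (range (\<lambda>l \<xi>. \<xi> $ l)) :: (real ^ 'm \<Rightarrow> real) set"
  show "finite ?C" by simp
  have coord: "real_polynomial_function (\<lambda>\<xi> :: real ^ 'm. \<xi> $ l)" for l
    by (intro real_polynomial_function.intros(1) bounded_linear_vec_nth)
  then have "real_polynomial_function (\<lambda>\<xi> :: real ^ 'm. \<Sum>l\<in>UNIV. \<xi> $ l)"
    by (rule real_polynomial_function_sum[OF finite])
  then have total: "real_polynomial_function (\<lambda>\<xi> :: real ^ 'm. (\<Sum>l\<in>UNIV. \<xi> $ l) - 1)"
    by (rule real_polynomial_function_diff[OF _ real_polynomial_function.intros(2)])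
  show "real_polynomial_function c" if "c \<in> ?C" for c
    using that by (elim insertE rangeE) (simp_all only: total coord)
  fix x y assume xy: "same_signs ?C x y" and x: "x \<in> std_simplex"
  have "0 \<le> y $ l" for l
  proof -
    have "0 \<le> x $ l" using x by (simp add: std_simplex_def)
    moreover have "sgn (x $ l) = sgn (y $ l)"
      by (rule same_signsD[OF xy, of "\<lambda>\<xi>. \<xi> $ l"]) simp
    ultimately show ?thesis by (auto simp: sgn_if split: if_splits)
  qed
  moreover have "(\<Sum>l\<in>UNIV. y $ l) = 1"
  proof -
    have "(\<Sum>l\<in>UNIV. x $ l) = 1" using x by (simp add: std_simplex_def)
    moreover have "sgn ((\<Sum>l\<in>UNIV. x $ l) - 1) = sgn ((\<Sum>l\<in>UNIV. y $ l) - 1)"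
      by (rule same_signsD[OF xy insertI1])
    ultimately have "sgn ((\<Sum>l\<in>UNIV. y $ l) - 1) = 0" by simp
    then show ?thesis unfolding sgn_zero_iff by simp
  qed
  ultimately show "y \<in> std_simplex" by (simp add: std_simplex_def)
qed

theorem proposition3p1:
  fixes K :: "(real ^ 'n) set"
    and F :: "'m::finite \<Rightarrow> real ^ 'n \<Rightarrow> real ^ 'n"
  assumes "K \<noteq> {}"
    and "semialgebraic K"
    and "\<And>l j. \<exists>p. real_polynomial_function p \<and> (\<forall>x\<in>K. F l x $ j = p x)"
  shows "semialgebraic_multifunction std_simplex (basic_multifunction K F)"
proof -
  obtain P where P: "\<And>l j. real_polynomial_function (P l j)"
    "\<And>l j x. x \<in> K \<Longrightarrow> F l x $ j = P l j x" using assms(3) by metis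
  \<comment> \<open>On \<open>K\<close> the map \<open>F\<close> may be replaced by the polynomials \<open>P\<close>. The pairs that violate the
    variational inequality are then the projection of \<open>g < 0\<close> over \<open>y \<in> K\<close>.\<close>
  define g where "g = (\<lambda>((\<xi> :: real ^ 'm, x), y). \<Sum>j\<in>UNIV. (\<Sum>l\<in>UNIV. \<xi> $ l * P l j x) * (y $ j - x $ j))"
  have g: "(\<Sum>l\<in>UNIV. \<xi> $ l *\<^sub>R F l x) \<bullet> (y - x) = g ((\<xi>, x), y)" if "x \<in> K" for \<xi> x y
    by (simp add: g_def inner_vec_def P(2)[OF that])
  have Px: "real_polynomial_function (\<lambda>w :: ((real ^ 'm) \<times> (real ^ 'n)) \<times> (real ^ 'n). P l j (snd (fst w)))" for l j
    using real_polynomial_function_compose[OF _ P(1)[of l j], of "\<lambda>w. snd (fst w)"]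
    by (simp add: o_def polynomial_function_bounded_linear bounded_linear_intros)
  have "real_polynomial_function g"
    unfolding g_def case_prod_beta
    by (intro real_polynomial_function_sum real_polynomial_function.intros(4)
        real_polynomial_function_diff Px real_polynomial_function.intros(1) finite
        bounded_linear_compose[OF bounded_linear_vec_nth] bounded_linear_intros)
  then have "semialgebraic ({w. g w < 0} \<inter> snd -` K)"
    using assms(2) by (intro semialgebraic_Int semialgebraic_negative semialgebraic_vimage
        polynomial_function_bounded_linear bounded_linear_snd)
  then have "semialgebraic {z. \<exists>y. (z, y) \<in> {w. g w < 0} \<inter> snd -` K}"
    by (rule semialgebraic_projection)
  then have "semialgebraic (fst -` std_simplex \<inter> snd -` K \<inter> - {z. \<exists>y. (z, y) \<in> {w. g w < 0} \<inter> snd -` K})"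
    using assms(2) semialgebraic_std_simplex
    by (intro semialgebraic_Int semialgebraic_Compl semialgebraic_vimage
        polynomial_function_bounded_linear bounded_linear_snd bounded_linear_fst)
  also have "fst -` std_simplex \<inter> snd -` K \<inter> - {z. \<exists>y. (z, y) \<in> {w. g w < 0} \<inter> snd -` K}
      = gph std_simplex (basic_multifunction K F)"
    by (auto simp: gph_def basic_multifunction_def g not_less)
  finally show ?thesis
    using semialgebraic_std_simplex by (simp add: semialgebraic_multifunction_def)
qed

end
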